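(* Let $m,n,k$ be positive integers with $m+n$ odd. Then the directed (multi)graph $G_{m,n,k}$ is strongly connected, i.e. for every ordered pair of vertices $(t,u)$ there is a directed path from $t$ to $u$.
   Context: Fix positive integers $m,n$ with $m+n$ odd (so $m\neq n$). For $x\in\{m,n\}$ write $\bar x=m+n-x$. For a finite or infinite sequence $s=(s_1,s_2,\dots)$ of positive integers and a letter $x\in\{m,n\}$, let $E(s,x)$ be the concatenation $x^{s_1}\,\bar x^{s_2}\,x^{s_3}\,\bar x^{s_4}\cdots$ (runs of lengths $s_1,s_2,\dots$ with values alternating, starting with $x$; here $y^{r}$ means $r$ copies of $y$). For a finite sequence $s$, let $C(s,x)=x$ if $|s|$ is even and $C(s,x)=\bar x$ if $|s|$ is odd. For $t=t_1t_2\cdots t_k\in\{m,n\}^k$ with $k\ge 2$ define recursively $E(s,t)=E(E(s,t_1),t_2\cdots t_k)$ and $C(s,t)=C(s,t_1)\,C(E(s,t_1),t_2\cdots t_k)$ (concatenation), so $C(s,t)\in\{m,n\}^k$. The graph $G_{m,n,k}$ has vertex set $\{m,n\}^k$ and, for each vertex $t$, exactly two outgoing edges: one from $t$ to $C(m,t)$ and one from $t$ to $C(n,t)$, where $m$ and $n$ are viewed as length-one sequences (for $k=1$ this is a multigraph). *)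

theory Defs
  imports "Graph_Theory.Digraph_Component"
begin

definition bar :: "nat \<Rightarrow> nat \<Rightarrow> nat \<Rightarrow> nat" where
  "bar m n x = m + n - x"

primrec run_expand :: "nat \<Rightarrow> nat \<Rightarrow> nat list \<Rightarrow> nat \<Rightarrow> nat list" where
  "run_expand m n [] x = []"
| "run_expand m n (r # s) x = replicate r x @ run_expand m n s (bar m n x)"

definition next_letter :: "nat \<Rightarrow> nat \<Rightarrow> nat list \<Rightarrow> nat \<Rightarrow> nat" where
  "next_letter m n s x = (if even (length s) then x else bar m n x)"

text \<open>
  The iterated operations \<open>E(s,t)\<close> and \<open>C(s,t)\<close> for a word \<open>t\<close>. They are extended to the
  empty word by \<open>E(s,[]) = s\<close> and \<open>C(s,[]) = []\<close>; on one-letter words this gives back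
  \<open>E(s,x)\<close> and \<open>C(s,x)\<close>.
\<close>

primrec run_expand_word :: "nat \<Rightarrow> nat \<Rightarrow> nat list \<Rightarrow> nat list \<Rightarrow> nat list" where
  "run_expand_word m n s [] = s"
| "run_expand_word m n s (x # t) = run_expand_word m n (run_expand m n s x) t"

primrec next_word :: "nat \<Rightarrow> nat \<Rightarrow> nat list \<Rightarrow> nat list \<Rightarrow> nat list" where
  "next_word m n s [] = []"
| "next_word m n s (x # t) = next_letter m n s x # next_word m n (run_expand m n s x) t"

definition words :: "nat \<Rightarrow> nat \<Rightarrow> nat \<Rightarrow> nat list set" where
  "words m n k = {t. set t \<subseteq> {m, n} \<and> length t = k}"

text \<open>
  The arc \<open>(t, a)\<close> runs from \<open>t\<close> to \<open>C(a,t)\<close>, so the two arcs leaving \<open>t\<close> are distinct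
  even if their heads coincide.
\<close>

definition kgraph :: "nat \<Rightarrow> nat \<Rightarrow> nat \<Rightarrow> (nat list, nat list \<times> nat) pre_digraph" where
  "kgraph m n k =
    \<lparr> verts = words m n k,
      arcs = words m n k \<times> {m, n},
      tail = fst,
      head = (\<lambda>(t, a). next_word m n [a] t) \<rparr>"

lemma length_next_word [simp]: "length (next_word m n s t) = length t"
  by (induction t arbitrary: s) auto

lemma set_next_word: "set t \<subseteq> {m, n} \<Longrightarrow> set (next_word m n s t) \<subseteq> {m, n}"
  by (induction t arbitrary: s) (auto simp: next_letter_def bar_def)

lemma fin_digraph_kgraph: "fin_digraph (kgraph m n k)"
proof
  show "finite (verts (kgraph m n k))" "finite (arcs (kgraph m n k))"
    by (auto simp: kgraph_def words_def finite_lists_length_eq)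
next
  fix e assume "e \<in> arcs (kgraph m n k)"
  then show "tail (kgraph m n k) e \<in> verts (kgraph m n k)"
    "head (kgraph m n k) e \<in> verts (kgraph m n k)"
    using set_next_word[of "fst e" m n "[snd e]"]
    by (auto simp: kgraph_def words_def)
qed

end

theory Submission
  imports Defs "HOL-Number_Theory.Cong"
begin

text \<open>
  Write \<open>\<phi>\<^sub>s\<close> for the map \<open>t \<mapsto> C(s,t)\<close> and \<open>x'\<close> for the letter other than \<open>x\<close>. Since
  \<open>\<phi>\<^sub>a(x t) = x' \<phi>\<^sub>x\<^sup>a(t)\<close>, these maps act on the binary rooted tree of words, and \<open>\<phi>\<^sub>s\<close> has order
  dividing \<open>2\<^sup>k\<close> on words of length \<open>k\<close>. Hence reachability is an equivalence relation. The two arcs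
  leaving \<open>x t\<close> show that \<open>x' \<phi>\<^sub>x\<^sup>m(t)\<close> and \<open>x' \<phi>\<^sub>x\<^sup>n(t)\<close> are equivalent. As \<open>m - n\<close> is odd and
  \<open>\<phi>\<^sub>x\<close> has 2-power order, \<open>x' t\<close> and \<open>x' \<phi>\<^sub>x(t)\<close> are equivalent; going through the other subtree,
  so are \<open>x t\<close> and \<open>x \<phi>\<^sub>x(t)\<close>. Thus the whole action on words of length \<open>k\<close> is available below each
  first letter, and induction on \<open>k\<close> applies.
\<close>

lemma concat_replicate_double: "concat (replicate (2 * j) s) = concat (replicate j (s @ s))"
  by (induction j) auto

lemma concat_replicate_replicate: "concat (replicate i (replicate j x)) = replicate (i * j) x"
  by (induction i) (auto simp: replicate_add)

lemma coprime_diff_mult_add_cong: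
  fixes a b N :: nat
  assumes "coprime (int a - int b) (int N)" "N > 0"
  obtains i j where "[a * i + j = 1] (mod N)" "[b * i + j = 0] (mod N)"
proof -
  obtain z where z_inverse: "[(int a - int b) * z = 1] (mod int N)"
    using cong_solve_coprime_int[OF assms(1)] by blast
  define i where "i = nat (z mod int N)"
  define j where "j = nat (- int b * z mod int N)"
  have i_cong: "[int i = z] (mod int N)" and j_cong: "[int j = - int b * z] (mod int N)"
    using assms(2) by (simp_all add: i_def j_def cong_def)
  have mult_add: "[int c * int i + int j = (int c - int b) * z] (mod int N)" for c
    using cong_add[OF cong_scalar_left[OF i_cong, of "int c"] j_cong] by (simp add: algebra_simps)
  have "[int (a * i + j) = int 1] (mod int N)"
    using cong_trans[OF mult_add z_inverse] by simp
  moreover have "[int (b * i + j) = int 0] (mod int N)"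
    using mult_add[of b] by simp
  ultimately show thesis
    using that unfolding cong_int_iff by blast
qed

lemma bar_mem: "x \<in> {m, n} \<Longrightarrow> bar m n x \<in> {m, n}"
  by (auto simp: bar_def)

lemma bar_bar: "x \<in> {m, n} \<Longrightarrow> bar m n (bar m n x) = x"
  by (auto simp: bar_def)

lemma bar_eq_other: "x \<in> {m, n} \<Longrightarrow> y \<in> {m, n} \<Longrightarrow> x \<noteq> y \<Longrightarrow> bar m n x = y"
  by (auto simp: bar_def)

lemma words_0: "words m n 0 = {[]}"
  by (auto simp: words_def)

lemma words_Suc: "words m n (Suc k) = {x # t |x t. x \<in> {m, n} \<and> t \<in> words m n k}"
  by (auto simp: words_def length_Suc_conv)

lemma next_word_in_words: "t \<in> words m n k \<Longrightarrow> next_word m n s t \<in> words m n k"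
  using set_next_word by (simp add: words_def)

lemma next_letter_append:
  "x \<in> {m, n} \<Longrightarrow> next_letter m n (s @ s') x = next_letter m n s' (next_letter m n s x)"
  by (auto simp: next_letter_def bar_bar)

lemma run_expand_append:
  "x \<in> {m, n} \<Longrightarrow>
    run_expand m n (s @ s') x = run_expand m n s x @ run_expand m n s' (next_letter m n s x)"
proof (induction s arbitrary: x)
  case Nil
  then show ?case by (simp add: next_letter_def)
next
  case (Cons r s)
  then have "next_letter m n (r # s) x = next_letter m n s (bar m n x)"
    by (auto simp: next_letter_def bar_bar)
  with Cons show ?case
    using bar_mem[OF Cons.prems] by simp
qed

lemma next_word_Nil: "next_word m n [] t = t"
  by (induction t) (simp_all add: next_letter_def)

lemma next_word_append:
  "set t \<subseteq> {m, n} \<Longrightarrow> next_word m n (s @ s') t = next_word m n s' (next_word m n s t)"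
  by (induction t arbitrary: s s') (auto simp: next_letter_append run_expand_append)

lemma next_word_replicate_add:
  "set t \<subseteq> {m, n} \<Longrightarrow>
    next_word m n (replicate (i + j) x) t =
      next_word m n (replicate j x) (next_word m n (replicate i x) t)"
  by (simp add: replicate_add next_word_append)

lemma run_expand_concat_replicate:
  assumes "x \<in> {m, n}" "even (length s)"
  shows "run_expand m n (concat (replicate j s)) x = concat (replicate j (run_expand m n s x))"
  using assms by (induction j) (auto simp: run_expand_append next_letter_def)

lemma next_word_concat_replicate_Cons:
  assumes "x \<in> {m, n}" "even (length s)"
  shows "next_word m n (concat (replicate j s)) (x # t) =
    x # next_word m n (concat (replicate j (run_expand m n s x))) t"
proof -
  have "even (length (concat (replicate j s)))"
    using assms(2) by (induction j) auto
  then show ?thesis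
    using assms by (simp add: next_letter_def run_expand_concat_replicate del: length_concat)
qed

lemma next_word_concat_replicate_power2:
  "set t \<subseteq> {m, n} \<Longrightarrow> next_word m n (concat (replicate (2 ^ length t) s)) t = t"
proof (induction t arbitrary: s)
  case Nil
  then show ?case by simp
next
  case (Cons x t)
  have "next_word m n (concat (replicate (2 ^ length (x # t)) s)) (x # t) =
      next_word m n (concat (replicate (2 ^ length t) (s @ s))) (x # t)"
    by (simp only: length_Cons power_Suc concat_replicate_double)
  also have "\<dots> = x # next_word m n
      (concat (replicate (2 ^ length t) (run_expand m n (s @ s) x))) t"
    using Cons.prems by (intro next_word_concat_replicate_Cons) auto
  also have "\<dots> = x # t"
    using Cons by simp
  finally show ?case .
qed

lemma next_word_replicate_mod:
  assumes "set t \<subseteq> {m, n}"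
  shows "next_word m n (replicate (i mod 2 ^ length t) x) t = next_word m n (replicate i x) t"
proof -
  define N :: nat where "N = 2 ^ length t"
  have "next_word m n (replicate (N * (i div N)) x) t = t"
    using next_word_concat_replicate_power2[OF assms, of "replicate (i div N) x"]
    by (simp add: N_def concat_replicate_replicate)
  then have "next_word m n (replicate (N * (i div N) + i mod N) x) t =
      next_word m n (replicate (i mod N) x) t"
    using assms by (simp only: next_word_replicate_add)
  then show ?thesis
    by (simp add: N_def)
qed

lemma next_word_replicate_cong:
  assumes "t \<in> words m n k" "[i = j] (mod 2 ^ k)"
  shows "next_word m n (replicate i x) t = next_word m n (replicate j x) t"
  using assms next_word_replicate_mod[of t m n i x] next_word_replicate_mod[of t m n j x]
  by (simp add: words_def cong_def)

interpretation kgraph: fin_digraph "kgraph m n k" for m n k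
  by (rule fin_digraph_kgraph)

lemma verts_kgraph: "verts (kgraph m n k) = words m n k"
  by (simp add: kgraph_def)

lemma adj_kgraph_iff:
  "t \<rightarrow>\<^bsub>kgraph m n k\<^esub> u \<longleftrightarrow> t \<in> words m n k \<and> (\<exists>a\<in>{m, n}. u = next_word m n [a] t)"
  by (auto simp: kgraph_def arcs_ends_def arc_to_ends_def image_iff)

lemma adj_kgraph_Cons:
  assumes "x \<in> {m, n}" "a \<in> {m, n}" "t \<in> words m n k"
  shows "(x # t) \<rightarrow>\<^bsub>kgraph m n (Suc k)\<^esub> (bar m n x # next_word m n (replicate a x) t)"
proof -
  have "next_word m n [a] (x # t) = bar m n x # next_word m n (replicate a x) t"
    by (simp add: next_letter_def)
  then show ?thesis
    using assms unfolding adj_kgraph_iff words_Suc by force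
qed

lemma reachable_kgraph_replicate:
  assumes "t \<in> words m n k" "a \<in> {m, n}"
  shows "t \<rightarrow>\<^sup>*\<^bsub>kgraph m n k\<^esub> next_word m n (replicate i a) t"
proof (induction i)
  case 0
  then show ?case
    using assms by (simp add: next_word_Nil verts_kgraph)
next
  case (Suc i)
  have "next_word m n (replicate (Suc i) a) t = next_word m n [a] (next_word m n (replicate i a) t)"
    using next_word_replicate_add[of t m n i 1 a] assms(1) by (simp add: words_def)
  then have "next_word m n (replicate i a) t \<rightarrow>\<^bsub>kgraph m n k\<^esub>
      next_word m n (replicate (Suc i) a) t"
    using assms by (auto simp: adj_kgraph_iff next_word_in_words)
  with Suc show ?case
    by (rule kgraph.reachable_adj_trans)
qed

lemma reachable_kgraph_sym:
  "t \<rightarrow>\<^sup>*\<^bsub>kgraph m n k\<^esub> u \<Longrightarrow> u \<rightarrow>\<^sup>*\<^bsub>kgraph m n k\<^esub> t"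
proof (induction rule: kgraph.reachable_induct)
  case base
  then show ?case ..
next
  case (step u v)
  then obtain a where u_word: "u \<in> words m n k" and a_mem: "a \<in> {m, n}"
    and v_eq: "v = next_word m n [a] u"
    by (auto simp: adj_kgraph_iff)
  have "next_word m n (replicate (2 ^ k - 1) a) v = next_word m n (replicate (2 ^ k) a) u"
    using next_word_replicate_add[of u m n 1 "2 ^ k - 1" a] u_word by (simp add: v_eq words_def)
  also have "\<dots> = next_word m n (replicate 0 a) u"
    using u_word by (rule next_word_replicate_cong) (simp add: cong_def)
  finally have "v \<rightarrow>\<^sup>*\<^bsub>kgraph m n k\<^esub> u"
    using reachable_kgraph_replicate[of v m n k a "2 ^ k - 1"] u_word a_mem
    by (simp add: v_eq next_word_in_words next_word_Nil)
  then show ?case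
    using step.IH by (rule kgraph.reachable_trans)
qed

lemma reachable_kgraph_bar_Cons_replicate:
  assumes x_mem: "x \<in> {m, n}" and t_word: "t \<in> words m n k"
  shows "(bar m n x # next_word m n (replicate m x) t) \<rightarrow>\<^sup>*\<^bsub>kgraph m n (Suc k)\<^esub>
    (bar m n x # next_word m n (replicate n x) t)"
proof -
  have "(x # t) \<rightarrow>\<^sup>*\<^bsub>kgraph m n (Suc k)\<^esub> (bar m n x # next_word m n (replicate m x) t)"
    using adj_kgraph_Cons[OF x_mem _ t_word] by simp
  then have "(bar m n x # next_word m n (replicate m x) t) \<rightarrow>\<^sup>*\<^bsub>kgraph m n (Suc k)\<^esub> (x # t)"
    by (rule reachable_kgraph_sym)
  also have "(x # t) \<rightarrow>\<^bsub>kgraph m n (Suc k)\<^esub> (bar m n x # next_word m n (replicate n x) t)"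
    using adj_kgraph_Cons[OF x_mem _ t_word] by simp
  finally (kgraph.reachable_adj_trans) show ?thesis .
qed

lemma reachable_kgraph_bar_Cons_replicate_mult_add:
  assumes x_mem: "x \<in> {m, n}" and t_word: "t \<in> words m n k"
  shows "(bar m n x # next_word m n (replicate (m * i + j) x) t) \<rightarrow>\<^sup>*\<^bsub>kgraph m n (Suc k)\<^esub>
    (bar m n x # next_word m n (replicate (n * i + j) x) t)"
proof (induction i arbitrary: j)
  case 0
  then show ?case
    using bar_mem[OF x_mem] t_word by (auto simp: verts_kgraph words_Suc next_word_in_words)
next
  case (Suc i)
  let ?pow = "\<lambda>p. next_word m n (replicate p x) t"
  have pow_add: "?pow (p + q) = next_word m n (replicate q x) (?pow p)" for p q
    using t_word by (simp add: next_word_replicate_add words_def)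
  have "(bar m n x # ?pow (m * i + j + m)) \<rightarrow>\<^sup>*\<^bsub>kgraph m n (Suc k)\<^esub>
      (bar m n x # ?pow (m * i + j + n))"
    unfolding pow_add[of "m * i + j"]
    using x_mem t_word by (intro reachable_kgraph_bar_Cons_replicate next_word_in_words)
  also have "(bar m n x # ?pow (m * i + j + n)) \<rightarrow>\<^sup>*\<^bsub>kgraph m n (Suc k)\<^esub>
      (bar m n x # ?pow (n * i + j + n))"
    using Suc.IH[of "j + n"] by (simp add: add.assoc)
  finally (kgraph.reachable_trans) show ?case
    by (simp add: algebra_simps)
qed

lemma reachable_kgraph_bar_Cons_next_word:
  assumes odd_sum: "odd (m + n)" and x_mem: "x \<in> {m, n}" and t_word: "t \<in> words m n k"
  shows "(bar m n x # t) \<rightarrow>\<^sup>*\<^bsub>kgraph m n (Suc k)\<^esub> (bar m n x # next_word m n [x] t)"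
proof -
  have "coprime (int m - int n) (int (2 ^ k))"
    using odd_sum by (simp add: coprime_power_right_iff)
  then obtain i j where ij_cong: "[m * i + j = 1] (mod 2 ^ k)" "[n * i + j = 0] (mod 2 ^ k)"
    by (rule coprime_diff_mult_add_cong) simp
  have "next_word m n (replicate (m * i + j) x) t = next_word m n [x] t"
    using next_word_replicate_cong[OF t_word ij_cong(1)] by simp
  moreover have "next_word m n (replicate (n * i + j) x) t = t"
    using next_word_replicate_cong[OF t_word ij_cong(2)] by (simp add: next_word_Nil)
  ultimately have "(bar m n x # next_word m n [x] t) \<rightarrow>\<^sup>*\<^bsub>kgraph m n (Suc k)\<^esub> (bar m n x # t)"
    using reachable_kgraph_bar_Cons_replicate_mult_add[OF x_mem t_word, of i j] by simp
  then show ?thesis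
    by (rule reachable_kgraph_sym)
qed

lemma reachable_kgraph_Cons_next_word_same:
  assumes odd_sum: "odd (m + n)" and x_mem: "x \<in> {m, n}" and t_word: "t \<in> words m n k"
  shows "(x # t) \<rightarrow>\<^sup>*\<^bsub>kgraph m n (Suc k)\<^esub> (x # next_word m n [x] t)"
proof -
  let ?v = "next_word m n (replicate n x) t"
  have commute: "next_word m n [x] ?v = next_word m n (replicate n x) (next_word m n [x] t)"
    using t_word by (simp add: words_def next_word_append[symmetric] replicate_append_same)
  have arc: "(x # u) \<rightarrow>\<^bsub>kgraph m n (Suc k)\<^esub> (bar m n x # next_word m n (replicate n x) u)"
    if "u \<in> words m n k" for u
    using x_mem _ that by (rule adj_kgraph_Cons) simp
  have "(x # t) \<rightarrow>\<^bsub>kgraph m n (Suc k)\<^esub> (bar m n x # ?v)"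
    using t_word by (rule arc)
  also have "(bar m n x # ?v) \<rightarrow>\<^sup>*\<^bsub>kgraph m n (Suc k)\<^esub> (bar m n x # next_word m n [x] ?v)"
    using odd_sum x_mem next_word_in_words[OF t_word] by (rule reachable_kgraph_bar_Cons_next_word)
  also have "(bar m n x # next_word m n [x] ?v) \<rightarrow>\<^sup>*\<^bsub>kgraph m n (Suc k)\<^esub>
      (x # next_word m n [x] t)"
    unfolding commute using arc[OF next_word_in_words[OF t_word]]
    by (rule reachable_kgraph_sym[OF kgraph.reachable_adjI])
  finally show ?thesis .
qed

lemma reachable_kgraph_Cons_next_word:
  assumes odd_sum: "odd (m + n)" and x_mem: "x \<in> {m, n}" and y_mem: "y \<in> {m, n}"
    and t_word: "t \<in> words m n k"
  shows "(x # t) \<rightarrow>\<^sup>*\<^bsub>kgraph m n (Suc k)\<^esub> (x # next_word m n [y] t)"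
proof (cases "y = x")
  case True
  then show ?thesis
    using reachable_kgraph_Cons_next_word_same[OF odd_sum x_mem t_word] by simp
next
  case False
  then have "bar m n y = x"
    using x_mem y_mem by (intro bar_eq_other)
  then show ?thesis
    using reachable_kgraph_bar_Cons_next_word[OF odd_sum y_mem t_word] by simp
qed

lemma reachable_kgraph_Cons:
  assumes odd_sum: "odd (m + n)" and x_mem: "x \<in> {m, n}" and t_reaches_u: "t \<rightarrow>\<^sup>*\<^bsub>kgraph m n k\<^esub> u"
  shows "(x # t) \<rightarrow>\<^sup>*\<^bsub>kgraph m n (Suc k)\<^esub> (x # u)"
  using t_reaches_u
proof (induction rule: kgraph.reachable_induct)
  case base
  then show ?case
    using x_mem by (auto simp: verts_kgraph words_Suc)
next
  case (step u v)
  have "(x # u) \<rightarrow>\<^sup>*\<^bsub>kgraph m n (Suc k)\<^esub> (x # v)"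
    using step.hyps(2) reachable_kgraph_Cons_next_word[OF odd_sum x_mem]
    by (auto simp: adj_kgraph_iff)
  with step.IH show ?case
    by (rule kgraph.reachable_trans)
qed

lemma reachable_kgraph:
  assumes odd_sum: "odd (m + n)"
  shows "t \<in> words m n k \<Longrightarrow> u \<in> words m n k \<Longrightarrow> t \<rightarrow>\<^sup>*\<^bsub>kgraph m n k\<^esub> u"
proof (induction k arbitrary: t u)
  case 0
  then show ?case by (simp add: words_0 verts_kgraph)
next
  case (Suc k)
  obtain x v where t_eq: "t = x # v" and x_mem: "x \<in> {m, n}" and v_word: "v \<in> words m n k"
    using Suc.prems(1) by (auto simp: words_Suc)
  obtain y w where u_eq: "u = y # w" and y_mem: "y \<in> {m, n}" and w_word: "w \<in> words m n k"
    using Suc.prems(2) by (auto simp: words_Suc)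
  have same_head: "t \<rightarrow>\<^sup>*\<^bsub>kgraph m n (Suc k)\<^esub> (x # v')" if "v' \<in> words m n k" for v'
    unfolding t_eq using odd_sum x_mem Suc.IH[OF v_word that] by (rule reachable_kgraph_Cons)
  show ?case
  proof (cases "y = x")
    case True
    then show ?thesis
      using same_head[OF w_word] u_eq by simp
  next
    case False
    then have "bar m n y = x"
      using x_mem y_mem by (intro bar_eq_other)
    then have "u \<rightarrow>\<^sup>*\<^bsub>kgraph m n (Suc k)\<^esub> (x # next_word m n (replicate n y) w)"
      using adj_kgraph_Cons[OF y_mem _ w_word, of n] u_eq by simp
    then have "(x # next_word m n (replicate n y) w) \<rightarrow>\<^sup>*\<^bsub>kgraph m n (Suc k)\<^esub> u"
      by (rule reachable_kgraph_sym)
    with same_head[OF next_word_in_words[OF w_word]] show ?thesis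
      by (rule kgraph.reachable_trans)
  qed
qed

theorem theorem2p3:
  fixes m n k :: nat
  assumes "m > 0" and "n > 0" and "k > 0" and "odd (m + n)"
  shows "strongly_connected (kgraph m n k)"
proof (rule strongly_connectedI)
  have "replicate k m \<in> verts (kgraph m n k)"
    by (auto simp: verts_kgraph words_def)
  then show "verts (kgraph m n k) \<noteq> {}"
    by blast
next
  fix t u
  assume "t \<in> verts (kgraph m n k)" "u \<in> verts (kgraph m n k)"
  then show "t \<rightarrow>\<^sup>*\<^bsub>kgraph m n k\<^esub> u"
    using \<open>odd (m + n)\<close> by (simp add: verts_kgraph reachable_kgraph)
qed

end
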